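(* Let $q\ge5$ be a prime power. Let $L_c$ be the line through $\mathbf{P}(1,0,0,1)$ and $\mathbf{P}(0,0,1,0)$, and for $\mu\in\mathbb{F}_q$ let $\ell_\mu$ be the line through $\mathbf{P}(0,\mu,0,1)$ and $\mathbf{P}(1,0,1,0)$. Let $\mu\in\mathbb{F}_q\setminus\{0,1\}$, with moreover $\mu\ne1/9$ when $q$ is odd and $q\not\equiv0\pmod3$. Then $L_c$ and $\ell_\mu$ belong to the same orbit of $G_q$ if and only if $q$ is odd, $\mu=-1/3$, and either $q\equiv-1\pmod{12}$ and $\mu$ is not a square in $\mathbb{F}_q$, or $q\equiv1\pmod{12}$, $\mu$ is a square in $\mathbb{F}_q$, $1/2$ is a cube in $\mathbb{F}_q$ and $-1/3$ is a fourth power in $\mathbb{F}_q$.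
   Context: Points of $\mathrm{PG}(3,q)$ are written $\mathbf{P}(x_0,x_1,x_2,x_3)$ in homogeneous coordinates over the field $\mathbb{F}_q$. The twisted cubic is $\mathscr{C}=\{\mathbf{P}(t^3,t^2,t,1):t\in\mathbb{F}_q\}\cup\{\mathbf{P}(1,0,0,0)\}$ and $G_q$ is the group of projectivities of $\mathrm{PG}(3,q)$ fixing $\mathscr{C}$. Two lines are in the same orbit if an element of $G_q$ maps one onto the other. *)

theory Defs
  imports "HOL-Analysis.Analysis"
begin

text \<open>Vectors of F_q^4; coordinates (x0,x1,x2,x3) stored at indices 1,2,3,4 (=0) of type 4.\<close>
definition vec4 :: "'a \<Rightarrow> 'a \<Rightarrow> 'a \<Rightarrow> 'a \<Rightarrow> 'a ^ 4" where
  "vec4 a b c d = (\<chi> i. if i = 1 then a else if i = 2 then b else if i = 3 then c else d)"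

definition proj_pt :: "'a::field ^ 4 \<Rightarrow> ('a ^ 4) set" where
  "proj_pt v = {c *s v | c. c \<noteq> 0}"

definition twisted_cubic :: "(('a::field) ^ 4) set set" where
  "twisted_cubic = proj_pt ` ({vec4 (t^3) (t^2) t 1 | t. True} \<union> {vec4 1 0 0 0})"

text \<open>Line through P(u), P(v) (u, v independent), as a 2-dim subspace.\<close>
definition proj_line :: "'a::field ^ 4 \<Rightarrow> 'a ^ 4 \<Rightarrow> ('a ^ 4) set" where
  "proj_line u v = {a *s u + b *s v | a b. True}"

definition fixes_cubic :: "'a::field ^ 4 ^ 4 \<Rightarrow> bool" where
  "fixes_cubic M \<longleftrightarrow> invertible M \<and> (\<lambda>P. (\<lambda>x. M *v x) ` P) ` twisted_cubic = twisted_cubic"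

definition same_orbit :: "('a::field ^ 4) set \<Rightarrow> ('a ^ 4) set \<Rightarrow> bool" where
  "same_orbit L L' \<longleftrightarrow> (\<exists>M. fixes_cubic M \<and> (\<lambda>x. M *v x) ` L = L')"

definition L_c :: "('a::field ^ 4) set" where
  "L_c = proj_line (vec4 1 0 0 1) (vec4 0 0 1 0)"

definition ell :: "'a::field \<Rightarrow> ('a ^ 4) set" where
  "ell \<mu> = proj_line (vec4 0 \<mu> 0 1) (vec4 1 0 1 0)"

end

theory Submission
  imports Defs
begin

text \<open>
  A projectivity M fixing the cubic induces a permutation of the parameter line. Normalise M by a
  symmetric cube so that it fixes the points with parameters 0 and \<infinity>; projecting from the chord
  through these two points shows that the permutation is t \<mapsto> k t or t \<mapsto> k / t on the other
  points, and the vanishing of a cubic polynomial at the q - 1 \<ge> 4 nonzero parameters excludes the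
  second case and makes M diagonal. Hence M is a multiple of the symmetric cube of a 2 by 2 matrix.

  The planes through a line form a pencil of binary cubic forms, so the question is when the pencils
  \<open>\<langle>x^3 - y^3, x^2 y\<rangle>\<close> and \<open>\<langle>x^3 - x y^2, x^2 y - \<mu> y^3\<rangle>\<close> differ by a linear substitution. Their
  Jacobians are the quartics \<open>x^4 + 2 x y^3\<close> and \<open>x^4 + (1 - 3\<mu>) x^2 y^2 + \<mu> y^4\<close>, whose invariants
  \<open>I = 12 a e - 3 b d + c^2\<close> are 0 and \<open>(3\<mu> + 1)^2\<close>. So \<open>\<mu> = -1/3\<close>, and then equivalence over the
  field amounts to 2 being a cube and the second quartic having a root, i.e. \<open>3 t^4 + 6 t^2 = 1\<close>
  being solvable. These two conditions are finally read off from q modulo 12.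
\<close>

subsection \<open>Powers in finite fields\<close>

text \<open>Multiplication by \<open>x\<close> permutes the nonzero elements, so it leaves their
  product unchanged.\<close>

lemma power_card_minus_one:
  fixes x :: "'a::{field,finite}"
  assumes "x \<noteq> 0"
  shows "x ^ (CARD('a) - 1) = 1"
proof -
  let ?U = "UNIV - {0::'a}"
  have "(\<Prod>y\<in>?U. y) = (\<Prod>y\<in>?U. x * y)"
    by (rule prod.reindex_bij_witness[where i = "\<lambda>y. x * y" and j = "\<lambda>y. y / x"])
      (use assms in auto)
  also have "\<dots> = x ^ card ?U * (\<Prod>y\<in>?U. y)"
    by (simp add: prod.distrib)
  finally have "x ^ card ?U = 1"
    by (simp add: prod_zero_iff)
  then show ?thesis
    by (simp add: card_Diff_subset)
qed

text \<open>The polynomial \<open>X^n - 1\<close> has at most \<open>n\<close> roots, too few to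
  cover all nonzero elements.\<close>

lemma ex_power_ne_one:
  assumes "0 < n" "n < CARD('a::{field,finite}) - 1"
  shows "\<exists>x::'a. x \<noteq> 0 \<and> x ^ n \<noteq> 1"
proof (rule ccontr)
  assume "\<not> ?thesis"
  then have sub: "UNIV - {0::'a} \<subseteq> {x. poly (monom 1 n - 1) x = 0}"
    by (auto simp: poly_monom)
  have ne: "monom (1::'a) n - 1 \<noteq> 0"
    using assms(1) by (metis degree_1 degree_monom_eq eq_iff_diff_eq_0 nat_less_le zero_neq_one)
  have "CARD('a) - 1 = card (UNIV - {0::'a})"
    by (simp add: card_Diff_subset)
  also have "\<dots> \<le> card {x::'a. poly (monom 1 n - 1) x = 0}"
    using sub by (intro card_mono) auto
  also have "\<dots> \<le> degree (monom (1::'a) n - 1)"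
    using ne by (rule card_poly_roots_bound)
  also have "\<dots> \<le> n"
    by (rule degree_diff_le) (simp_all add: degree_monom_le)
  finally show False
    using assms(2) by simp
qed

text \<open>The orbits of \<open>f\<close> partition \<open>A\<close> into blocks of exactly three
  elements.\<close>

lemma three_dvd_card_of_order_three:
  assumes "finite A" "\<And>x. x \<in> A \<Longrightarrow> f x \<in> A" "\<And>x. x \<in> A \<Longrightarrow> f (f (f x)) = x"
    "\<And>x. x \<in> A \<Longrightarrow> f x \<noteq> x"
  shows "3 dvd card A"
proof -
  define C where "C = (\<lambda>x. {x, f x, f (f x)}) ` A"
  have U: "\<Union>C = A"
    using assms(2) by (auto simp: C_def)
  have "3 dvd card (\<Union>C)"
  proof (rule dvd_partition)
    show "finite (\<Union>C)"
      using U assms(1) by simp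
    show "\<forall>c\<in>C. 3 dvd card c"
    proof
      fix c assume "c \<in> C"
      then obtain x where x: "x \<in> A" "c = {x, f x, f (f x)}"
        by (auto simp: C_def)
      have "f x \<noteq> x" "f (f x) \<noteq> f x" "f (f x) \<noteq> x"
        using x assms(2-4) by metis+
      then have "card c = 3"
        using x by auto
      then show "3 dvd card c"
        by simp
    qed
    show "\<forall>c1\<in>C. \<forall>c2\<in>C. c1 \<noteq> c2 \<longrightarrow> c1 \<inter> c2 = {}"
    proof -
      have "{x, f x, f (f x)} = {y, f y, f (f y)}"
        if "x \<in> A" "y \<in> A" "z \<in> {x, f x, f (f x)}" "z \<in> {y, f y, f (f y)}" for x y z
      proof -
        have *: "{x, f x, f (f x)} = {z, f z, f (f z)}" if "x \<in> A" "z \<in> {x, f x, f (f x)}" for x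
          using that assms(3) by auto
        show ?thesis
          using *[of x] *[of y] that by simp
      qed
      then show ?thesis
        unfolding C_def by blast
    qed
  qed
  then show ?thesis
    using U by simp
qed

section \<open>Squares, cubes and the residue of q modulo 2, 3 and 4\<close>

lemma two_ne_zero_imp_odd_card:
  assumes "(2::'a::{field,finite}) \<noteq> 0"
  shows "odd CARD('a)"
proof
  assume "even CARD('a)"
  then have "odd (CARD('a) - 1)"
    by (simp add: Suc_leI)
  then have "(-1::'a) = 1"
    using power_card_minus_one[of "-1::'a"] by simp
  then show False
    using assms by (metis add.right_inverse one_add_one)
qed

text \<open>Translating the sum of all elements by 1 shows that q vanishes in the field; if q is odd
  and 2 = 0, this reads 1 = 0.\<close>

lemma odd_card_imp_two_ne_zero:
  assumes "odd CARD('a::{field,finite})"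
  shows "(2::'a) \<noteq> 0"
proof
  assume 2: "(2::'a) = 0"
  have "(\<Sum>y\<in>UNIV. y) = (\<Sum>y\<in>UNIV. y + (1::'a))"
    by (rule sum.reindex_bij_witness[where i = "\<lambda>y. y + 1" and j = "\<lambda>y. y - 1"]) auto
  then have "of_nat CARD('a) = (0::'a)"
    by (simp add: sum.distrib)
  moreover obtain m where "CARD('a) = 2 * m + 1"
    using assms by (elim oddE)
  ultimately show False
    using 2 by simp
qed

text \<open>If \<open>x^((q-1)/2)\<close> is not 1 then it is -1, and it is the square of
  \<open>x^((q-1)/4)\<close>.\<close>

lemma card_mod_four_imp_minus_one_square:
  assumes "CARD('a::{field,finite}) mod 4 = 1"
  shows "\<exists>i::'a. i^2 = -1"
proof -
  define k where "k = CARD('a) div 4"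
  have q: "CARD('a) - 1 = 4 * k"
    using assms by (simp add: k_def minus_mod_eq_mult_div[symmetric])
  have "k > 0"
  proof (rule ccontr)
    assume "\<not> k > 0"
    then have "CARD('a) = 1"
      using q by (metis One_nat_def Suc_pred mult_0_right not_gr0 zero_less_card_finite)
    then have "(0::'a) = 1"
      by (metis card_1_singletonE UNIV_I singletonD)
    then show False
      by simp
  qed
  then obtain x :: 'a where x: "x \<noteq> 0" "x ^ (2 * k) \<noteq> 1"
    using ex_power_ne_one[of "2 * k", where 'a='a] q by auto
  have "x ^ (4 * k) = 1"
    using power_card_minus_one[OF x(1)] q by simp
  moreover have "x ^ (4 * k) = (x ^ (2 * k))\<^sup>2"
    by (simp flip: power_mult)
  ultimately have "x ^ (2 * k) = -1"
    using x(2) by (simp add: power2_eq_1_iff)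
  then have "(x ^ k)\<^sup>2 = -1"
    by (simp flip: power_mult add: mult.commute)
  then show ?thesis ..
qed

lemma minus_one_square_imp_card_mod_four:
  fixes i :: "'a::{field,finite}"
  assumes "i^2 = -1" "(2::'a) \<noteq> 0"
  shows "CARD('a) mod 4 = 1"
proof -
  have "i \<noteq> 0"
    using assms(1) by auto
  then have 1: "i ^ (CARD('a) - 1) = 1"
    by (rule power_card_minus_one)
  obtain m where m: "CARD('a) = 2 * m + 1"
    using two_ne_zero_imp_odd_card[OF assms(2)] by (elim oddE)
  have "(-1::'a) ^ m = 1"
    using 1 m assms(1) by (simp add: power_mult)
  moreover have "(-1::'a) \<noteq> 1"
    using assms(2) by (metis add.right_inverse one_add_one)
  ultimately have "even m"
    by (metis neg_one_odd_power)
  then show ?thesis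
    using m by (elim evenE) simp
qed

lemma omega_of_sqrt_minus_three:
  fixes r :: "'a::field"
  assumes "r^2 = -3" "(2::'a) \<noteq> 0" "(3::'a) \<noteq> 0"
  shows "\<exists>w::'a. w^2 + w + 1 = 0 \<and> w^3 = 1 \<and> w \<noteq> 1"
proof -
  define w where "w = (r - 1) / 2"
  have r: "r = 2 * w + 1"
    using assms(2) by (simp add: w_def field_simps)
  have "4 * (w^2 + w + 1) = r^2 + 3"
    unfolding r by algebra
  moreover have "(4::'a) \<noteq> 0"
    using assms(2) by (metis mult_2 mult_eq_0_iff numeral_Bit0)
  ultimately have w: "w^2 + w + 1 = 0"
    using assms(1) by (metis add.left_inverse mult_eq_0_iff)
  moreover have "w^3 = 1"
    using w by algebra
  moreover have "w \<noteq> 1"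
    using w assms(3) by auto
  ultimately show ?thesis
    by blast
qed

text \<open>A square root of -3 yields an element of multiplicative order 3, and this order divides
  q - 1.\<close>

lemma minus_three_square_imp_card_mod_three:
  fixes r :: "'a::{field,finite}"
  assumes "r^2 = -3" "(2::'a) \<noteq> 0" "(3::'a) \<noteq> 0"
  shows "CARD('a) mod 3 = 1"
proof -
  obtain w :: 'a where w: "w^2 + w + 1 = 0" "w^3 = 1" "w \<noteq> 1"
    using omega_of_sqrt_minus_three[OF assms] by blast
  have "w \<noteq> 0"
    using w(2) by auto
  then have 1: "w ^ (CARD('a) - 1) = 1"
    by (rule power_card_minus_one)
  define n where "n = CARD('a) - 1"
  have "w ^ n = w ^ (3 * (n div 3) + n mod 3)"
    by simp
  also have "\<dots> = w ^ (n mod 3)"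
    by (simp only: power_add power_mult w(2)) simp
  finally have p: "w ^ (n mod 3) = 1"
    using 1 n_def by simp
  have "w^2 \<noteq> 1"
    using w by (metis mult.left_neutral power2_eq_square power3_eq_cube)
  then have "n mod 3 \<noteq> 1" "n mod 3 \<noteq> 2"
    using p w(3) by (auto simp: numeral_2_eq_2)
  then have "n mod 3 = 0"
    by linarith
  moreover have "CARD('a) = n + 1"
    by (simp add: n_def)
  ultimately show ?thesis
    by presburger
qed

text \<open>The map \<open>x \<mapsto> 1 / (1 - x)\<close> has order three on the q - 2 elements
  other than 0 and 1; a fixed point satisfies \<open>x^2 - x + 1 = 0\<close>, whose discriminant is
  -3.\<close>

lemma minus_three_not_square_imp_card_mod_three:
  assumes "\<not> (\<exists>r::'a::{field,finite}. r^2 = -3)"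
  shows "CARD('a) mod 3 = 2"
proof -
  let ?A = "UNIV - {0, 1::'a}" and ?f = "\<lambda>x::'a. 1 / (1 - x)"
  have "3 dvd card ?A"
  proof (rule three_dvd_card_of_order_three)
    fix x assume x: "x \<in> ?A"
    then have x': "x \<noteq> 0" "1 - x \<noteq> 0"
      by auto
    then show "?f x \<in> ?A"
      by (auto simp: field_simps)
    have "1 - ?f x = - x / (1 - x)"
      using x' by (simp add: field_simps)
    then have "?f (?f x) = (x - 1) / x"
      using x' by (simp add: field_simps)
    then show "?f (?f (?f x)) = x"
      using x' by (simp add: field_simps)
    show "?f x \<noteq> x"
    proof
      assume "?f x = x"
      then have "x * (1 - x) = 1"
        using x' by (simp add: field_simps)
      then have "(2 * x - 1)^2 = -3"
        by algebra
      then show False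
        using assms by blast
    qed
  qed simp
  moreover have "card ?A = CARD('a) - 2"
    by (simp add: card_Diff_subset)
  moreover have "CARD('a) \<ge> 2"
    using card_mono[of UNIV "{0, 1::'a}"] by simp
  ultimately show ?thesis
    by presburger
qed

lemma cube_surj:
  fixes x :: "'a::{field,finite}"
  assumes "CARD('a) mod 3 = 2"
  shows "\<exists>y. y^3 = x"
proof (cases "x = 0")
  case False
  define k where "k = CARD('a) div 3"
  have q: "CARD('a) - 1 = 3 * k + 1"
    using assms by (simp add: k_def minus_mod_eq_mult_div[symmetric])
  \<comment> \<open>The exponent \<open>2 * k + 1\<close> inverts 3 modulo q - 1, since
    \<open>3 * (2 * k + 1) = 2 * (3 * k + 1) + 1\<close>.\<close>
  have "(x ^ (2 * k + 1)) ^ 3 = (x ^ (3 * k + 1))^2 * x"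
    unfolding power_mult[symmetric] power_Suc2[symmetric] by (rule arg_cong[of _ _ "power x"]) simp
  then have "(x ^ (2 * k + 1)) ^ 3 = x"
    using power_card_minus_one[OF False] q by simp
  then show ?thesis ..
qed auto

text \<open>Here (q - 1)/2 = \<open>2 * k + 1\<close> is odd and \<open>x^(2 * k + 1)\<close> is a
  sign, so multiplying it by \<open>x\<close> gives an even power equal to \<open>x\<close> or
  \<open>- x\<close>.\<close>

lemma square_or_minus_square:
  fixes x :: "'a::{field,finite}"
  assumes "CARD('a) mod 4 = 3"
  shows "\<exists>y. y^2 = x \<or> y^2 = - x"
proof (cases "x = 0")
  case False
  define k where "k = CARD('a) div 4"
  have q: "CARD('a) - 1 = 2 * (2 * k + 1)"
    using assms by (simp add: k_def minus_mod_eq_mult_div[symmetric])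
  have "(x ^ (2 * k + 1))^2 = 1"
    using power_card_minus_one[OF False] unfolding q by (metis mult.commute power_mult)
  then have "x ^ (2 * k + 1) = 1 \<or> x ^ (2 * k + 1) = -1"
    by (simp add: power2_eq_1_iff)
  moreover have "(x ^ (k + 1))^2 = x ^ (2 * k + 1) * x"
    unfolding power_mult[symmetric] power_Suc2[symmetric] by (rule arg_cong[of _ _ "power x"]) simp
  ultimately have "(x ^ (k + 1))^2 = x \<or> (x ^ (k + 1))^2 = - x"
    by auto
  then show ?thesis ..
qed auto

subsection \<open>Symmetric cubes and the stabiliser of the twisted cubic\<close>

lemma vec4_nth [simp]:
  "vec4 a b c d $ 1 = a" "vec4 a b c d $ 2 = b" "vec4 a b c d $ 3 = c" "vec4 a b c d $ 4 = d"
  by (simp_all add: vec4_def)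

lemma vec_eq_iff_4: "v = w \<longleftrightarrow> v $ 1 = w $ 1 \<and> v $ 2 = w $ 2 \<and> v $ 3 = w $ 3 \<and> v $ 4 = w $ (4::4)"
  by (simp add: vec_eq_iff forall_4)

lemma matrix_vector_mult_nth4:
  "(M *v v) $ i = M$i$1 * v$1 + M$i$2 * v$2 + M$i$3 * v$3 + M$i$4 * v$(4::4)"
  by (simp add: matrix_vector_mult_def sum_4)

text \<open>Homogeneous form of the parametrisation: the parameter is \<open>s / t\<close>, and
  \<open>cub 1 0\<close> is the point at infinity.\<close>

definition cub :: "'a::field \<Rightarrow> 'a \<Rightarrow> 'a ^ 4" where
  "cub s t = vec4 (s^3) (s^2 * t) (s * t^2) (t^3)"

text \<open>The rows are the coefficients of \<open>(a t + b)^3\<close>, \<open>(a t + b)^2 (c t + d)\<close>,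
  \<open>(a t + b) (c t + d)^2\<close>, \<open>(c t + d)^3\<close>.\<close>

definition sym3 :: "'a::field \<Rightarrow> 'a \<Rightarrow> 'a \<Rightarrow> 'a \<Rightarrow> 'a ^ 4 ^ 4" where
  "sym3 a b c d = vec4
    (vec4 (a^3) (3 * a^2 * b) (3 * a * b^2) (b^3))
    (vec4 (a^2 * c) (a^2 * d + 2 * a * b * c) (2 * a * b * d + b^2 * c) (b^2 * d))
    (vec4 (a * c^2) (2 * a * c * d + b * c^2) (a * d^2 + 2 * b * c * d) (b * d^2))
    (vec4 (c^3) (3 * c^2 * d) (3 * c * d^2) (d^3))"

lemma cub_nth [simp]:
  "cub s t $ 1 = s^3" "cub s t $ 2 = s^2 * t" "cub s t $ 3 = s * t^2" "cub s t $ 4 = t^3"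
  by (simp_all add: cub_def)

lemma cub_scale: "cub (k * s) (k * t) = k^3 *s cub s t"
  by (simp add: vec_eq_iff_4 power_mult_distrib power2_eq_square power3_eq_cube)

lemma sym3_cub: "sym3 a b c d *v cub s t = cub (a * s + b * t) (c * s + d * t)"
  unfolding vec_eq_iff_4 matrix_vector_mult_nth4 sym3_def vec4_nth cub_nth
  by (intro conjI; algebra)

lemma sym3_mult:
  "sym3 a b c d ** sym3 a' b' c' d' =
    sym3 (a * a' + b * c') (a * b' + b * d') (c * a' + d * c') (c * b' + d * d')"
  by (simp add: vec_eq_iff_4 matrix_matrix_mult_def sum_4 sym3_def algebra_simps
      power2_eq_square power3_eq_cube)

lemma sym3_1: "sym3 1 0 0 1 = mat 1"
  by (simp add: vec_eq_iff_4 sym3_def mat_def)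

lemma invertible_sym3:
  assumes "a * d - b * c \<noteq> 0"
  shows "invertible (sym3 a b c d)"
proof -
  define D where "D = a * d - b * c"
  have "d / D * a + - b / D * c = (a * d - b * c) / D" "d / D * b + - b / D * d = 0"
    "- c / D * a + a / D * c = 0" "- c / D * b + a / D * d = (a * d - b * c) / D"
    by (simp_all add: diff_divide_distrib mult.commute)
  moreover have "(a * d - b * c) / D = 1"
    using assms by (simp add: D_def)
  ultimately have "sym3 (d / D) (- b / D) (- c / D) (a / D) ** sym3 a b c d = mat 1"
    by (simp only: sym3_mult sym3_1)
  then show ?thesis
    by (metis invertible_left_inverse)
qed

section \<open>Projective points and the homogeneous description of the cubic\<close>

lemma proj_pt_smult:
  fixes k :: "'a::field"
  assumes "k \<noteq> 0"
  shows "proj_pt (k *s v) = proj_pt v"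
proof -
  have "\<exists>c'. c *s v = c' *s (k *s v) \<and> c' \<noteq> 0" if "c \<noteq> 0" for c
    using that assms by (intro exI[of _ "c / k"]) simp
  moreover have "\<exists>c'. c *s (k *s v) = c' *s v \<and> c' \<noteq> 0" if "c \<noteq> 0" for c
    using that assms by (intro exI[of _ "c * k"]) simp
  ultimately show ?thesis
    unfolding proj_pt_def by (intro set_eqI) blast
qed

lemma proj_pt_eqD:
  assumes "proj_pt u = proj_pt v"
  shows "\<exists>k. k \<noteq> 0 \<and> u = k *s v"
proof -
  have "u \<in> proj_pt u"
    unfolding proj_pt_def by (intro CollectI exI[of _ 1]) simp
  then have "u \<in> proj_pt v"
    using assms by simp
  then show ?thesis
    unfolding proj_pt_def mem_Collect_eq by metis
qed

lemma matrix_image_proj_pt: "(\<lambda>x. M *v x) ` proj_pt v = proj_pt (M *v v)"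
proof -
  have "proj_pt v = (\<lambda>c. c *s v) ` {c. c \<noteq> 0}" for v :: "'a ^ 4"
    unfolding proj_pt_def by blast
  then show ?thesis
    by (simp add: image_image vector_scalar_commute)
qed

lemma twisted_cubic_eq: "twisted_cubic = {proj_pt (cub s t) | s t :: 'a::field. s \<noteq> 0 \<or> t \<noteq> 0}"
proof (intro set_eqI iffI)
  fix P :: "('a ^ 4) set"
  assume "P \<in> twisted_cubic"
  then consider t where "P = proj_pt (cub t 1)" | "P = proj_pt (cub 1 0)"
    by (auto simp: twisted_cubic_def cub_def)
  then show "P \<in> {proj_pt (cub s t) | s t. s \<noteq> 0 \<or> t \<noteq> 0}"
  proof cases
    case 1
    have "P = proj_pt (cub t 1) \<and> (t \<noteq> 0 \<or> (1::'a) \<noteq> 0)"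
      using 1 by simp
    then show ?thesis by blast
  next
    case 2
    have "P = proj_pt (cub 1 0) \<and> ((1::'a) \<noteq> 0 \<or> (0::'a) \<noteq> 0)"
      using 2 by simp
    then show ?thesis by blast
  qed
next
  fix P :: "('a ^ 4) set"
  assume "P \<in> {proj_pt (cub s t) | s t. s \<noteq> 0 \<or> t \<noteq> 0}"
  then obtain s t where P: "P = proj_pt (cub s t)" "s \<noteq> 0 \<or> t \<noteq> 0"
    by blast
  show "P \<in> twisted_cubic"
  proof (cases "t = 0")
    case True
    then have "P = proj_pt (vec4 1 0 0 0)"
      using P proj_pt_smult[of "s^3" "cub 1 0"] cub_scale[of s 1 0] by (simp add: cub_def)
    then show ?thesis
      by (auto simp: twisted_cubic_def)
  next
    case False
    then have "P = proj_pt (vec4 ((s/t)^3) ((s/t)^2) (s/t) 1)"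
      using P proj_pt_smult[of "t^3" "cub (s/t) 1"] cub_scale[of t "s/t" 1] by (simp add: cub_def)
    then show ?thesis
      unfolding twisted_cubic_def by blast
  qed
qed

lemma fixes_cubic_sym3:
  fixes a b c d :: "'a::field"
  assumes D: "a * d - b * c \<noteq> 0"
  shows "fixes_cubic (sym3 a b c d)"
  unfolding fixes_cubic_def
proof (intro conjI)
  show "invertible (sym3 a b c d)"
    by (rule invertible_sym3[OF D])
  let ?f = "\<lambda>P. (\<lambda>x. sym3 a b c d *v x) ` P"
  show "?f ` twisted_cubic = twisted_cubic"
  proof (intro equalityI subsetI)
    fix P assume "P \<in> ?f ` twisted_cubic"
    then obtain s t where P: "P = proj_pt (cub (a * s + b * t) (c * s + d * t))" "s \<noteq> 0 \<or> t \<noteq> 0"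
      unfolding twisted_cubic_eq by (auto simp: matrix_image_proj_pt sym3_cub)
    have "a * s + b * t \<noteq> 0 \<or> c * s + d * t \<noteq> 0"
    proof (rule ccontr)
      assume "\<not> ?thesis"
      then have "(a * d - b * c) * s = 0" "(a * d - b * c) * t = 0"
        by algebra+
      then show False using D P(2) by simp
    qed
    then show "P \<in> twisted_cubic"
      unfolding P(1) twisted_cubic_eq by blast
  next
    fix P :: "('a ^ 4) set"
    assume "P \<in> twisted_cubic"
    then obtain s t where P: "P = proj_pt (cub s t)" "s \<noteq> 0 \<or> t \<noteq> 0"
      unfolding twisted_cubic_eq by blast
    \<comment> \<open>The adjugate matrix applied to \<open>(s, t)\<close>; applying the matrix
      again returns \<open>(s, t)\<close> times the determinant.\<close>
    let ?s = "d * s - b * t" and ?t = "a * t - c * s"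
    have eq: "a * ?s + b * ?t = (a * d - b * c) * s" "c * ?s + d * ?t = (a * d - b * c) * t"
      by algebra+
    have "?f (proj_pt (cub ?s ?t)) = P"
      unfolding matrix_image_proj_pt sym3_cub eq cub_scale
      using D P(1) by (subst proj_pt_smult) auto
    moreover have "?s \<noteq> 0 \<or> ?t \<noteq> 0"
      using eq D P(2) by (metis add.right_neutral mult_eq_0_iff)
    then have "proj_pt (cub ?s ?t) \<in> twisted_cubic"
      unfolding twisted_cubic_eq by blast
    ultimately show "P \<in> ?f ` twisted_cubic"
      by blast
  qed
qed

section \<open>Every projectivity fixing the cubic is a symmetric cube\<close>

lemma fixes_cubic_cubD:
  assumes "fixes_cubic M" "s \<noteq> 0 \<or> t \<noteq> 0"
  shows "\<exists>k s' t'. k \<noteq> 0 \<and> (s' \<noteq> 0 \<or> t' \<noteq> 0) \<and> M *v cub s t = k *s cub s' t'"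
proof -
  have "proj_pt (cub s t) \<in> twisted_cubic"
    using assms(2) unfolding twisted_cubic_eq by blast
  then have "proj_pt (M *v cub s t) \<in> twisted_cubic"
    using assms(1) unfolding fixes_cubic_def matrix_image_proj_pt[symmetric] by blast
  then show ?thesis
    unfolding twisted_cubic_eq using proj_pt_eqD by blast
qed

text \<open>A nonzero cubic has at most three roots, whereas there are at least four nonzero
  parameters. This is where q >= 5 enters.\<close>

lemma cubic_vanishes:
  fixes c0 c1 c2 c3 :: "'a::{field,finite}"
  assumes "CARD('a) \<ge> 5" "\<And>t. t \<noteq> 0 \<Longrightarrow> c0 + c1 * t + c2 * t^2 + c3 * t^3 = 0"
  shows "c0 = 0 \<and> c1 = 0 \<and> c2 = 0 \<and> c3 = 0"
proof (rule ccontr)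
  assume n: "\<not> ?thesis"
  let ?p = "[:c0, c1, c2, c3:]"
  have sub: "UNIV - {0} \<subseteq> {t. poly ?p t = 0}"
    using assms(2) by (auto simp: algebra_simps power2_eq_square power3_eq_cube)
  have "4 \<le> card (UNIV - {0::'a})"
    using assms(1) by (simp add: card_Diff_subset)
  also have "\<dots> \<le> card {t. poly ?p t = 0}"
    using sub by (intro card_mono) auto
  also have "\<dots> \<le> degree ?p"
    using n by (intro card_poly_roots_bound) auto
  also have "\<dots> \<le> 3"
    by (auto intro!: degree_pCons_le[THEN order_trans])
  finally show False
    by simp
qed

lemma invertible_mult_vec_parallelD:
  fixes M :: "'a::field ^ 'n ^ 'n"
  assumes "invertible M" "M *v u = k *s (M *v v)"
  shows "u = k *s v"
proof -
  have "M *v u = M *v (k *s v)"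
    using assms(2) by (simp add: vector_scalar_commute)
  then show ?thesis
    using assms(1) by (metis invertible_def matrix_vector_mul_assoc matrix_vector_mul_lid)
qed

lemma fixes_cubic_mult:
  assumes "fixes_cubic M" "fixes_cubic N"
  shows "fixes_cubic (M ** N)"
  unfolding fixes_cubic_def
proof (intro conjI)
  show "invertible (M ** N)"
    using assms by (simp add: fixes_cubic_def invertible_mult)
  have "(\<lambda>P. (\<lambda>x. (M ** N) *v x) ` P) =
      (\<lambda>P. (\<lambda>x. M *v x) ` P) \<circ> (\<lambda>P. (\<lambda>x. N *v x) ` P)"
    by (simp add: fun_eq_iff image_image matrix_vector_mul_assoc)
  then show "(\<lambda>P. (\<lambda>x. (M ** N) *v x) ` P) ` twisted_cubic = twisted_cubic"
    using assms unfolding fixes_cubic_def by (simp only: image_comp[symmetric])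
qed

lemma fixes_cubic_diagonal:
  fixes N :: "'a::{field,finite} ^ 4 ^ 4"
  assumes q: "CARD('a) \<ge> 5" and N: "fixes_cubic N"
    and N0: "N *v cub 1 0 = A *s cub 1 0" and N3: "N *v cub 0 1 = D *s cub 0 1"
    and AD: "A \<noteq> 0" "D \<noteq> 0"
  shows "\<exists>k. k \<noteq> 0 \<and> N = vec4 (vec4 (D * k^3) 0 0 0) (vec4 0 (D * k^2) 0 0)
    (vec4 0 0 (D * k) 0) (vec4 0 0 0 D)"
proof -
  note inj = invertible_mult_vec_parallelD[OF conjunct1[OF N[unfolded fixes_cubic_def]]]
  have c1: "N$1$1 = A" "N$2$1 = 0" "N$3$1 = 0" "N$4$1 = 0"
    using N0 by (simp_all add: vec_eq_iff_4 matrix_vector_mult_nth4)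
  have c4: "N$1$4 = 0" "N$2$4 = 0" "N$3$4 = 0" "N$4$4 = D"
    using N3 by (simp_all add: vec_eq_iff_4 matrix_vector_mult_nth4)
  define p0 p1 p2 p3 where p: "p0 = N$1$2" "p1 = N$2$2" "p2 = N$3$2" "p3 = N$4$2"
  define r0 r1 r2 r3 where r: "r0 = N$1$3" "r1 = N$2$3" "r2 = N$3$3" "r3 = N$4$3"
  have Nv: "N *v vec4 x0 x1 x2 x3 =
      vec4 (A*x0 + p0*x1 + r0*x2) (p1*x1 + r1*x2) (p2*x1 + r2*x2) (p3*x1 + r3*x2 + D*x3)"
    for x0 x1 x2 x3
    by (simp add: vec_eq_iff_4 matrix_vector_mult_nth4 c1 c4 p r)
  \<comment> \<open>The image of \<open>cub t 1\<close> lies on the cubic away from the two fixed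
    points, so its coordinates are nonzero and satisfy \<open>y0 * y2 = y1^2\<close> and
    \<open>y1 * y3 = y2^2\<close>; common powers of \<open>t\<close> are cancelled.\<close>
  have pts: "p1*t + r1 \<noteq> 0 \<and> p2*t + r2 \<noteq> 0 \<and>
      (A*t^2 + p0*t + r0) * (p2*t + r2) = (p1*t + r1)^2 \<and>
      (p1*t + r1) * (p3*t^2 + r3*t + D) = t * (p2*t + r2)^2" if t: "t \<noteq> 0" for t
  proof -
    obtain k s' t' where k: "k \<noteq> 0" "s' \<noteq> 0 \<or> t' \<noteq> 0" "N *v cub t 1 = k *s cub s' t'"
      using fixes_cubic_cubD[OF N, of t 1] by auto
    have "t' \<noteq> 0"
    proof
      assume t': "t' = 0"
      have "N *v cub t 1 = (k * s'^3 / A) *s (N *v cub 1 0)"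
        unfolding k(3) N0 t' using AD by (simp add: vec_eq_iff_4)
      then have "cub t 1 = (k * s'^3 / A) *s cub 1 0"
        by (rule inj)
      then show False
        by (simp add: vec_eq_iff_4)
    qed
    have "s' \<noteq> 0"
    proof
      assume s': "s' = 0"
      have "N *v cub t 1 = (k * t'^3 / D) *s (N *v cub 0 1)"
        unfolding k(3) N3 s' using AD by (simp add: vec_eq_iff_4)
      then have "cub t 1 = (k * t'^3 / D) *s cub 0 1"
        by (rule inj)
      then show False
        using t by (simp add: vec_eq_iff_4)
    qed
    have y: "t * (A*t^2 + p0*t + r0) = k * s'^3" "t * (p1*t + r1) = k * s'^2 * t'"
      "t * (p2*t + r2) = k * s' * t'^2" "p3*t^2 + r3*t + D = k * t'^3"
      using k(3) by (simp_all add: cub_def Nv vec_eq_iff_4 algebra_simps power2_eq_square power3_eq_cube)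
    have "p1*t + r1 \<noteq> 0" "p2*t + r2 \<noteq> 0"
      using y(2,3) k(1) \<open>s' \<noteq> 0\<close> \<open>t' \<noteq> 0\<close> by auto
    moreover have "t^2 * ((A*t^2 + p0*t + r0) * (p2*t + r2)) = t^2 * (p1*t + r1)^2"
      "t * ((p1*t + r1) * (p3*t^2 + r3*t + D)) = t * (t * (p2*t + r2)^2)"
      using y by algebra+
    ultimately show ?thesis
      using t by simp
  qed
  \<comment> \<open>\<open>N\<close> is injective and maps the span of the two fixed points onto
    itself, so no other vector enters that span.\<close>
  have nc: "u = 0 \<and> v = 0" if "N *v vec4 0 u v 0 = vec4 w 0 0 z" for u v w z
  proof -
    have "N *v vec4 0 u v 0 = 1 *s (N *v vec4 (w / A) 0 0 (z / D))"
      unfolding that unfolding Nv using AD by (simp add: vec_eq_iff_4)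
    then have "vec4 0 u v 0 = 1 *s vec4 (w / A) 0 0 (z / D)"
      by (rule inj)
    then show ?thesis
      by (simp add: vec_eq_iff_4)
  qed
  have 1: "\<not> (r1 = 0 \<and> r2 = 0)"
    using nc[of 0 1 r0 r3] by (auto simp: Nv)
  have 2: "\<not> (p1 = 0 \<and> p2 = 0)"
    using nc[of 1 0 p0 p3] by (auto simp: Nv)
  \<comment> \<open>Otherwise \<open>p1*t + r1\<close> would vanish at the nonzero parameter
    \<open>- r1 / p1\<close>.\<close>
  have 3: "p1 = 0 \<or> r1 = 0"
    using pts[of "- r1 / p1"] by (cases "p1 = 0"; cases "r1 = 0") auto
  have 4: "p2 = 0 \<or> r2 = 0"
    using pts[of "- r2 / p2"] by (cases "p2 = 0"; cases "r2 = 0") auto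
  \<comment> \<open>\<open>p1 = 0\<close> is the case in which the parameter is sent to \<open>k / t\<close>.\<close>
  have "p1 \<noteq> 0"
  proof
    assume [simp]: "p1 = 0"
    then have "p2 \<noteq> 0" and [simp]: "r2 = 0"
      using 2 4 by auto
    have "- (r1 * D) + - (r1 * r3) * t + - (r1 * p3) * t^2 + p2^2 * t^3 = 0" if "t \<noteq> 0" for t
      using pts[OF that] by (simp add: algebra_simps power2_eq_square power3_eq_cube)
    then show False
      using cubic_vanishes[OF q, of "- (r1 * D)" "- (r1 * r3)" "- (r1 * p3)" "p2^2"] \<open>p2 \<noteq> 0\<close> by simp
  qed
  then have [simp]: "r1 = 0" and "r2 \<noteq> 0" and [simp]: "p2 = 0"
    using 1 3 4 by auto
  have "(p1 * D - r2^2) + p1 * r3 * t + p1 * p3 * t^2 + 0 * t^3 = 0" if "t \<noteq> 0" for t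
  proof -
    have "p1 * (p3*t^2 + r3*t + D) = r2^2"
      using pts[OF that] that by simp
    then show ?thesis
      by (simp add: algebra_simps)
  qed
  then have a: "p1 * D = r2^2" "r3 = 0" "p3 = 0"
    using cubic_vanishes[OF q, of "p1 * D - r2^2" "p1 * r3" "p1 * p3" 0] \<open>p1 \<noteq> 0\<close> by auto
  have "r0 * r2 + p0 * r2 * t + (A * r2 - p1^2) * t^2 + 0 * t^3 = 0" if "t \<noteq> 0" for t
    using pts[OF that] by (simp add: algebra_simps power2_eq_square)
  then have b: "A * r2 = p1^2" "r0 = 0" "p0 = 0"
    using cubic_vanishes[OF q, of "r0 * r2" "p0 * r2" "A * r2 - p1^2" 0] \<open>r2 \<noteq> 0\<close> by auto
  \<comment> \<open>The multiplier of the induced map \<open>t \<mapsto> k * t\<close> on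
    parameters.\<close>
  define k where "k = p1 / r2"
  have "k \<noteq> 0"
    using \<open>p1 \<noteq> 0\<close> \<open>r2 \<noteq> 0\<close> by (simp add: k_def)
  have kr: "p1 = k * r2"
    using \<open>r2 \<noteq> 0\<close> by (simp add: k_def)
  have "D * k = r2"
    using a(1) \<open>r2 \<noteq> 0\<close> unfolding kr by (simp add: power2_eq_square mult.commute)
  moreover have "D * k^2 = p1"
    unfolding kr using calculation by (simp add: power2_eq_square mult_ac)
  moreover have "A = k^2 * r2"
    using b(1) \<open>r2 \<noteq> 0\<close> unfolding kr by (simp add: power2_eq_square)
  moreover have "D * k^3 = A"
    using calculation kr by (simp add: power2_eq_square power3_eq_cube mult_ac)
  ultimately have "N = vec4 (vec4 (D * k^3) 0 0 0) (vec4 0 (D * k^2) 0 0)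
      (vec4 0 0 (D * k) 0) (vec4 0 0 0 D)"
    using a b c1 c4 p r by (simp add: vec_eq_iff_4)
  then show ?thesis
    using \<open>k \<noteq> 0\<close> by blast
qed

lemma fixes_cubic_imp_sym3:
  fixes M :: "'a::{field,finite} ^ 4 ^ 4"
  assumes q: "CARD('a) \<ge> 5" and M: "fixes_cubic M"
  shows "\<exists>m a b c d. m \<noteq> 0 \<and> a * d - b * c \<noteq> 0 \<and> (\<forall>v. M *v v = m *s (sym3 a b c d *v v))"
proof -
  note inj = invertible_mult_vec_parallelD[OF conjunct1[OF M[unfolded fixes_cubic_def]]]
  obtain k1 s1 t1 where 1: "k1 \<noteq> 0" "s1 \<noteq> 0 \<or> t1 \<noteq> 0" "M *v cub 1 0 = k1 *s cub s1 t1"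
    using fixes_cubic_cubD[OF M, of 1 0] by auto
  obtain k2 s2 t2 where 2: "k2 \<noteq> 0" "s2 \<noteq> 0 \<or> t2 \<noteq> 0" "M *v cub 0 1 = k2 *s cub s2 t2"
    using fixes_cubic_cubD[OF M, of 0 1] by auto
  \<comment> \<open>If this determinant vanished, the images of the parameters infinity and 0 would
    coincide, against injectivity.\<close>
  define E where "E = s1 * t2 - s2 * t1"
  have "E \<noteq> 0"
  proof
    assume "E = 0"
    then have E: "s1 * t2 = s2 * t1"
      by (simp add: E_def)
    obtain l where l: "s1 = l * s2" "t1 = l * t2"
    proof (cases "s2 = 0")
      case True
      then show ?thesis
        using E 2(2) that[of "t1 / t2"] by auto
    next
      case False
      then show ?thesis
        using E that[of "s1 / s2"] by (simp add: field_simps)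
    qed
    have "M *v cub 1 0 = (k1 * l^3 / k2) *s (M *v cub 0 1)"
      unfolding 1(3) 2(3) l cub_scale using 2(1) by simp
    then have "cub 1 0 = (k1 * l^3 / k2) *s cub 0 1"
      by (rule inj)
    then show False
      by (simp add: vec_eq_iff_4)
  qed
  \<comment> \<open>The adjugate of the matrix with columns \<open>(s1, t1)\<close> and
    \<open>(s2, t2)\<close> carries the two image points back to infinity and 0.\<close>
  define N where "N = sym3 t2 (- s2) (- t1) s1 ** M"
  have N: "fixes_cubic N"
    unfolding N_def using \<open>E \<noteq> 0\<close>
    by (intro fixes_cubic_mult fixes_cubic_sym3 M) (simp add: E_def mult.commute)
  have N0: "N *v cub 1 0 = (k1 * E^3) *s cub 1 0"
    using cub_scale[of E 1 0] unfolding N_def matrix_vector_mul_assoc[symmetric] 1(3)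
    by (simp add: vector_scalar_commute sym3_cub E_def mult.commute)
  have N3: "N *v cub 0 1 = (k2 * E^3) *s cub 0 1"
    using cub_scale[of E 0 1] unfolding N_def matrix_vector_mul_assoc[symmetric] 2(3)
    by (simp add: vector_scalar_commute sym3_cub E_def mult.commute)
  obtain k where k: "k \<noteq> 0" "N = vec4 (vec4 (k2 * E^3 * k^3) 0 0 0) (vec4 0 (k2 * E^3 * k^2) 0 0)
      (vec4 0 0 (k2 * E^3 * k) 0) (vec4 0 0 0 (k2 * E^3))"
    using fixes_cubic_diagonal[OF q N N0 N3] 1(1) 2(1) \<open>E \<noteq> 0\<close> by auto
  \<comment> \<open>Undo the normalisation: the matrix times its adjugate is \<open>E\<close> times
    the identity, whose symmetric cube is the scalar \<open>E^3\<close>.\<close>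
  have "M *v v = k2 *s (sym3 (s1 * k) s2 (t1 * k) t2 *v v)" for v
  proof -
    have Nv: "N *v v = (k2 * E^3) *s (sym3 k 0 0 1 *v v)"
      unfolding k(2) by (simp add: vec_eq_iff_4 matrix_vector_mult_nth4 sym3_def)
    have "sym3 s1 s2 t1 t2 *v (N *v v) = (sym3 s1 s2 t1 t2 ** sym3 t2 (- s2) (- t1) s1) *v (M *v v)"
      by (simp add: N_def matrix_vector_mul_assoc matrix_mul_assoc)
    also have "\<dots> = sym3 E 0 0 E *v (M *v v)"
      by (simp add: sym3_mult E_def mult.commute)
    also have "\<dots> = E^3 *s (M *v v)"
      by (simp add: vec_eq_iff_4 matrix_vector_mult_nth4 sym3_def power2_eq_square power3_eq_cube mult_ac)
    finally have "E^3 *s (M *v v) = sym3 s1 s2 t1 t2 *v (N *v v)" ..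
    also have "\<dots> = (k2 * E^3) *s ((sym3 s1 s2 t1 t2 ** sym3 k 0 0 1) *v v)"
      unfolding Nv by (simp add: vector_scalar_commute matrix_vector_mul_assoc)
    also have "\<dots> = E^3 *s (k2 *s (sym3 (s1 * k) s2 (t1 * k) t2 *v v))"
      by (simp add: sym3_mult mult.commute)
    finally show ?thesis
      using \<open>E \<noteq> 0\<close> vector_mul_lcancel[of "E^3"] power_not_zero by blast
  qed
  moreover have "(s1 * k) * t2 - s2 * (t1 * k) \<noteq> 0"
    using \<open>E \<noteq> 0\<close> k(1) by (simp add: E_def mult.commute mult.left_commute right_diff_distrib[symmetric] del: right_diff_distrib')
  ultimately show ?thesis
    using 2(1) by blast
qed

subsection \<open>The two lines and their pencils of binary cubics\<close>

text \<open>The two equations are planes through the line; on \<open>cub x y\<close> they become the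
  generators \<open>x^3 - x y^2\<close> and \<open>x^2 y - \<mu> y^3\<close> of its pencil.\<close>

lemma mem_ell_iff: "v \<in> ell \<mu> \<longleftrightarrow> v $ 1 = v $ 3 \<and> v $ 2 = \<mu> * v $ 4"
proof
  assume "v $ 1 = v $ 3 \<and> v $ 2 = \<mu> * v $ 4"
  then have "v = v $ 4 *s vec4 0 \<mu> 0 1 + v $ 1 *s vec4 1 0 1 0"
    by (simp add: vec_eq_iff_4 mult.commute)
  then show "v \<in> ell \<mu>"
    unfolding ell_def proj_line_def by blast
qed (auto simp: ell_def proj_line_def mult.commute)

lemma mem_L_c_iff: "v \<in> L_c \<longleftrightarrow> v $ 4 = v $ 1 \<and> v $ 2 = 0"
proof
  assume "v $ 4 = v $ 1 \<and> v $ 2 = 0"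
  then have "v = v $ 1 *s vec4 1 0 0 1 + v $ 3 *s vec4 0 0 1 0"
    by (simp add: vec_eq_iff_4)
  then show "v \<in> L_c"
    unfolding L_c_def proj_line_def by blast
qed (auto simp: L_c_def proj_line_def)

text \<open>Equality of these finite sizes later turns an inclusion of lines into an
  equality.\<close>

lemma card_L_c_eq_card_ell: "card (L_c :: ('a::{field,finite} ^ 4) set) = card (ell (\<mu> :: 'a))"
proof (rule bij_betw_same_card)
  show "bij_betw (\<lambda>v. vec4 (v $ 1) (\<mu> * v $ 3) (v $ 1) (v $ 3)) L_c (ell \<mu>)"
    by (rule bij_betw_byWitness[where f' = "\<lambda>v. vec4 (v $ 1) 0 (v $ 4) (v $ 1)"])
      (auto simp: mem_L_c_iff mem_ell_iff vec_eq_iff_4)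
qed

text \<open>The four equations put the images of the two spanning vectors of \<open>L_c\<close> on
  the two planes of \<open>ell \<mu>\<close>; the scalar relating \<open>M\<close> to a symmetric
  cube drops out.\<close>

lemma same_orbit_iff:
  fixes \<mu> :: "'a::{field,finite}"
  assumes q: "CARD('a) \<ge> 5"
  shows "same_orbit L_c (ell \<mu>) \<longleftrightarrow> (\<exists>a b c d. a * d - b * c \<noteq> 0 \<and>
    a^3 + b^3 = a * c^2 + b * d^2 \<and> a^2 * c + b^2 * d = \<mu> * (c^3 + d^3) \<and>
    3 * a * b^2 = a * d^2 + 2 * b * c * d \<and> 2 * a * b * d + b^2 * c = \<mu> * (3 * c * d^2))"
    (is "_ \<longleftrightarrow> (\<exists>a b c d. ?P a b c d)")
proof -
  have mem: "(\<forall>v\<in>L_c. sym3 a b c d *v v \<in> ell \<mu>) \<longleftrightarrow>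
    a^3 + b^3 = a * c^2 + b * d^2 \<and> a^2 * c + b^2 * d = \<mu> * (c^3 + d^3) \<and>
    3 * a * b^2 = a * d^2 + 2 * b * c * d \<and> 2 * a * b * d + b^2 * c = \<mu> * (3 * c * d^2)"
    (is "?L \<longleftrightarrow> ?R") for a b c d
  proof
    assume L: ?L
    have "vec4 1 0 0 1 \<in> L_c" "vec4 0 0 1 0 \<in> L_c"
      by (simp_all add: mem_L_c_iff)
    with L have "sym3 a b c d *v vec4 1 0 0 1 \<in> ell \<mu>" "sym3 a b c d *v vec4 0 0 1 0 \<in> ell \<mu>"
      by blast+
    then show ?R
      by (simp add: mem_ell_iff matrix_vector_mult_nth4 sym3_def)
  next
    assume R: ?R
    show ?L
    proof
      fix v :: "'a ^ 4"
      assume "v \<in> L_c"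
      then have v: "v $ 4 = v $ 1" "v $ 2 = 0"
        by (simp_all add: mem_L_c_iff)
      then show "sym3 a b c d *v v \<in> ell \<mu>"
        unfolding mem_ell_iff matrix_vector_mult_nth4 sym3_def vec4_nth v
        by (intro conjI; insert R; elim conjE; algebra)
    qed
  qed
  show ?thesis
  proof
    assume "same_orbit L_c (ell \<mu>)"
    then obtain M where M: "fixes_cubic M" "(\<lambda>x. M *v x) ` L_c = ell \<mu>"
      unfolding same_orbit_def by blast
    obtain m a b c d where abcd: "m \<noteq> 0" "a * d - b * c \<noteq> 0"
      "\<And>v. M *v v = m *s (sym3 a b c d *v v)"
      using fixes_cubic_imp_sym3[OF q M(1)] by blast
    have "sym3 a b c d *v v \<in> ell \<mu>" if "v \<in> L_c" for v
    proof -
      have "M *v v \<in> ell \<mu>"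
        using M(2) that by blast
      then have "m *s (sym3 a b c d *v v) \<in> ell \<mu>"
        by (simp only: abcd(3))
      then show ?thesis
        using abcd(1) by (simp add: mem_ell_iff mult.left_commute)
    qed
    then show "\<exists>a b c d. ?P a b c d"
      using mem abcd(2) by blast
  next
    assume "\<exists>a b c d. ?P a b c d"
    then obtain a b c d where D: "a * d - b * c \<noteq> 0"
      and sub: "\<And>v. v \<in> L_c \<Longrightarrow> sym3 a b c d *v v \<in> ell \<mu>"
      using mem by blast
    have "inj_on (\<lambda>x. sym3 a b c d *v x) L_c"
      using invertible_mult_vec_parallelD[OF invertible_sym3[OF D], of _ 1]
      by (auto intro: inj_onI)
    then have "(\<lambda>x. sym3 a b c d *v x) ` L_c = ell \<mu>"
      using sub by (intro card_subset_eq) (auto simp: card_image card_L_c_eq_card_ell)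
    then show "same_orbit L_c (ell \<mu>)"
      unfolding same_orbit_def using fixes_cubic_sym3[OF D] by blast
  qed
qed

text \<open>Three times \<open>W\<close> is the Jacobian of \<open>x^3 - x y^2\<close> and
  \<open>x^2 y - \<mu> y^3\<close>; dropping the 3 keeps it meaningful in characteristic three. A
  change of basis of the pencil only rescales the Jacobian, and a substitution multiplies it by its
  determinant.\<close>

lemma wronskian_pencil:
  fixes a b c d \<mu> :: "'a::field"
  assumes D: "a * d - b * c \<noteq> 0"
    and E: "a^3 + b^3 = a * c^2 + b * d^2" "a^2 * c + b^2 * d = \<mu> * (c^3 + d^3)"
      "3 * a * b^2 = a * d^2 + 2 * b * c * d" "2 * a * b * d + b^2 * c = \<mu> * (3 * c * d^2)"
  defines "W \<equiv> \<lambda>x y. x^4 + (1 - 3 * \<mu>) * x^2 * y^2 + \<mu> * y^4"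
  shows "3 * \<mu> + 1 = 0"
    and "\<exists>w. w \<noteq> 0 \<and> (\<forall>x y. W (a * x + b * y) (c * x + d * y) = w * (x^4 + 2 * x * y^3))"
proof -
  define \<Delta> where "\<Delta> = a * d - b * c"
  have \<Delta>: "\<Delta> \<noteq> 0"
    using D by (simp add: \<Delta>_def)
  \<comment> \<open>Coefficients of the generators \<open>x^3 - x y^2\<close> and \<open>x^2 y - \<mu> y^3\<close> after the substitution; by the
    hypotheses they lie in the span of \<open>x^3 - y^3\<close> and \<open>x^2 y\<close>.\<close>
  define a0 a1 a2 a3 where A: "a0 = a^3 - a * c^2" "a1 = 3 * a^2 * b - 2 * a * c * d - b * c^2"
    "a2 = 3 * a * b^2 - a * d^2 - 2 * b * c * d" "a3 = b^3 - b * d^2"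
  define b0 b1 b2 b3 where B: "b0 = a^2 * c - \<mu> * c^3" "b1 = a^2 * d + 2 * a * b * c - 3 * \<mu> * c^2 * d"
    "b2 = 2 * a * b * d + b^2 * c - 3 * \<mu> * c * d^2" "b3 = b^2 * d - \<mu> * d^3"
  have lin: "a2 = 0" "b2 = 0" "a3 = - a0" "b3 = - b0"
    using E unfolding A B by algebra+
  define w4 w3 w2 w1 w0 where w: "w4 = W a c"
    "w3 = 4 * a^3 * b + (1 - 3 * \<mu>) * (2 * a * b * c^2 + 2 * a^2 * c * d) + 4 * \<mu> * c^3 * d"
    "w2 = 6 * a^2 * b^2 + (1 - 3 * \<mu>) * (b^2 * c^2 + 4 * a * b * c * d + a^2 * d^2) + 6 * \<mu> * c^2 * d^2"
    "w1 = 4 * a * b^3 + (1 - 3 * \<mu>) * (2 * b^2 * c * d + 2 * a * b * d^2) + 4 * \<mu> * c * d^3"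
    "w0 = W b d"
  have Wexp: "W (a * x + b * y) (c * x + d * y)
      = w4 * x^4 + w3 * x^3 * y + w2 * x^2 * y^2 + w1 * x * y^3 + w0 * y^4" for x y
    unfolding w W_def by algebra
  \<comment> \<open>Coefficient by coefficient, the Jacobian of the substituted generators, without
    the factor 3, is \<open>\<Delta>\<close> times the substituted \<open>W\<close>.\<close>
  have "\<Delta> * w4 = a0 * b1 - a1 * b0"
    unfolding w W_def \<Delta>_def A B by algebra
  moreover have "\<Delta> * w3 = 2 * (a0 * b2 - a2 * b0)"
    unfolding w W_def \<Delta>_def A B by algebra
  moreover have "\<Delta> * w2 = 3 * (a0 * b3 - a3 * b0) + (a1 * b2 - a2 * b1)"
    unfolding w W_def \<Delta>_def A B by algebra
  moreover have "\<Delta> * w1 = 2 * (a1 * b3 - a3 * b1)"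
    unfolding w W_def \<Delta>_def A B by algebra
  moreover have "\<Delta> * w0 = a2 * b3 - a3 * b2"
    unfolding w W_def \<Delta>_def A B by algebra
  ultimately have "\<Delta> * w3 = 0" "\<Delta> * w2 = 0" "\<Delta> * w0 = 0" "\<Delta> * w1 = \<Delta> * (2 * w4)"
    using lin by algebra+
  then have ws: "w3 = 0" "w2 = 0" "w0 = 0" "w1 = 2 * w4"
    using \<Delta> by simp_all
  \<comment> \<open>The invariant I of the quartic has weight 4.\<close>
  have "12 * w4 * w0 - 3 * w3 * w1 + w2^2 = \<Delta>^4 * (3 * \<mu> + 1)^2"
    unfolding w W_def \<Delta>_def by algebra
  then show "3 * \<mu> + 1 = 0"
    using \<Delta> ws by simp
  have eq: "W (a * x + b * y) (c * x + d * y) = w4 * (x^4 + 2 * x * y^3)" for x y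
    unfolding Wexp ws by algebra
  \<comment> \<open>The substitution sends \<open>(d, - c)\<close> to \<open>(\<Delta>, 0)\<close>,
    where \<open>W\<close> is nonzero.\<close>
  have "W (a * d + b * (- c)) (c * d + d * (- c)) = \<Delta>^4"
    by (simp add: W_def \<Delta>_def mult.commute)
  then have "w4 \<noteq> 0"
    unfolding eq using \<Delta> by auto
  then show "\<exists>w. w \<noteq> 0 \<and> (\<forall>x y. W (a * x + b * y) (c * x + d * y) = w * (x^4 + 2 * x * y^3))"
    using eq by blast
qed

lemma pencil_equiv_iff:
  fixes \<mu> :: "'a::field"
  assumes "\<mu> \<noteq> 1"
  shows "(\<exists>a b c d. a * d - b * c \<noteq> 0 \<and>
    a^3 + b^3 = a * c^2 + b * d^2 \<and> a^2 * c + b^2 * d = \<mu> * (c^3 + d^3) \<and>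
    3 * a * b^2 = a * d^2 + 2 * b * c * d \<and> 2 * a * b * d + b^2 * c = \<mu> * (3 * c * d^2)) \<longleftrightarrow>
    (2::'a) \<noteq> 0 \<and> 3 * \<mu> + 1 = 0 \<and> (\<exists>z::'a. z^3 = 2) \<and> (\<exists>x::'a. 3 * x^4 + 6 * x^2 = 1)"
    (is "?L \<longleftrightarrow> ?R")
proof
  assume ?L
  then obtain a b c d where D: "a * d - b * c \<noteq> 0" and
    E: "a^3 + b^3 = a * c^2 + b * d^2" "a^2 * c + b^2 * d = \<mu> * (c^3 + d^3)"
      "3 * a * b^2 = a * d^2 + 2 * b * c * d" "2 * a * b * d + b^2 * c = \<mu> * (3 * c * d^2)"
    by blast
  have \<mu>: "3 * \<mu> + 1 = 0"
    by (rule wronskian_pencil(1)[OF D E])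
  have 2: "(2::'a) \<noteq> 0"
  proof
    assume "(2::'a) = 0"
    moreover have "\<mu> - 1 = (3 * \<mu> + 1) - 2 * (\<mu> + 1)"
      by algebra
    ultimately have "\<mu> = 1"
      using \<mu> by simp
    with assms show False ..
  qed
  have 3: "(3::'a) \<noteq> 0"
    using \<mu> by auto
  obtain w where w: "w \<noteq> 0" and W: "\<And>x y. (a * x + b * y)^4 + (1 - 3 * \<mu>) * (a * x + b * y)^2 * (c * x + d * y)^2
      + \<mu> * (c * x + d * y)^4 = w * (x^4 + 2 * x * y^3)"
    using wronskian_pencil(2)[OF D E] by blast
  \<comment> \<open>\<open>(0, 1)\<close> is a zero of \<open>x^4 + 2 x y^3\<close>, so its image
    \<open>(b, d)\<close> is a zero of the other quartic.\<close>
  have W0: "b^4 + (1 - 3 * \<mu>) * b^2 * d^2 + \<mu> * d^4 = 0"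
    using W[of 0 1] by simp
  have d: "d \<noteq> 0"
    using W0 D by auto
  have "\<mu> \<noteq> 0"
    using \<mu> by auto
  then have b: "b \<noteq> 0"
    using W0 d by auto
  \<comment> \<open>The quartic is even, so with \<open>b / d\<close> also \<open>- b / d\<close> is a root; its preimage is a nonzero root of
    \<open>x^4 + 2 x y^3\<close>.\<close>
  have "(a * (- 2 * b * d) + b * (a * d + b * c)) = - b * (a * d - b * c)"
    "(c * (- 2 * b * d) + d * (a * d + b * c)) = d * (a * d - b * c)"
    by algebra+
  then have "w * ((- 2 * b * d)^4 + 2 * (- 2 * b * d) * (a * d + b * c)^3) = 0"
    unfolding W[symmetric] using W0 by algebra
  then have "w * ((- 2 * b * d) * ((- 2 * b * d)^3 + 2 * (a * d + b * c)^3)) = 0"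
    by algebra
  then have "(- 2 * b * d) * ((- 2 * b * d)^3 + 2 * (a * d + b * c)^3) = 0"
    using w by (metis mult_eq_0_iff)
  then have cube: "(2 * b * d)^3 = 2 * (a * d + b * c)^3"
    using 2 b d by (simp add: power3_eq_cube)
  moreover have "a * d + b * c \<noteq> 0"
    using cube 2 b d by auto
  ultimately have z: "(2 * b * d / (a * d + b * c))^3 = 2"
    by (simp add: power_divide)
  have "3 * (b^4 + 2 * b^2 * d^2) = d^4"
    using W0 \<mu> by algebra
  then have "3 * (b / d)^4 + 6 * (b / d)^2 = 1"
    using d by (simp add: field_simps power_numeral_reduce)
  with 2 \<mu> z show ?R
    by blast
next
  assume ?R
  then obtain z x :: 'a where 2: "(2::'a) \<noteq> 0" and \<mu>: "3 * \<mu> + 1 = 0" and z: "z^3 = 2" and x: "3 * x^4 + 6 * x^2 = 1"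
    by blast
  have 3: "(3::'a) \<noteq> 0"
    using \<mu> by auto
  \<comment> \<open>The substitution sends the roots \<open>0\<close> and \<open>- z\<close> of \<open>t^4 + 2 t\<close> to \<open>x\<close> and \<open>- x\<close>, and \<open>\<infinity>\<close> to the third
    zero \<open>- (1 + x^2) / (2 x)\<close> of the cubic of the pencil that has the double zero \<open>x\<close>.\<close>
  let ?a = "- 2 * x * (1 + x^2)" and ?b = "- x * (1 - x^2) * z" and ?c = "4 * x^2" and ?d = "- (1 - x^2) * z"
  have "x \<noteq> 0"
    using x by auto
  have "z \<noteq> 0"
    using z 2 by auto
  have x': "3 * x^4 + 6 * x^2 - 1 = 0"
    using x by simp
  \<comment> \<open>The polynomial \<open>3 * x^4 + 6 * x^2 - 1\<close> takes the value 8 at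
    \<open>x^2 = 1\<close> and -8/3 at \<open>x^2 = -1/3\<close>, so neither factor of the
    determinant vanishes.\<close>
  have "1 - x^2 \<noteq> 0"
  proof
    assume "1 - x^2 = 0"
    moreover have "2^3 = (3 * x^4 + 6 * x^2 - 1) + (1 - x^2) * (3 * x^2 + 9)"
      by algebra
    ultimately have "(2::'a)^3 = 0"
      by (simp only: x' mult_zero_left mult_zero_right add_0)
    then show False
      using 2 by (metis power_not_zero)
  qed
  have "1 + 3 * x^2 \<noteq> 0"
  proof
    assume "1 + 3 * x^2 = 0"
    moreover have "2^3 = - 3 * (3 * x^4 + 6 * x^2 - 1) + (1 + 3 * x^2) * (3 * x^2 + 5)"
      by algebra
    ultimately have "(2::'a)^3 = 0"
      by (simp only: x' mult_zero_left mult_zero_right add_0)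
    then show False
      using 2 by (metis power_not_zero)
  qed
  have "?a * ?d - ?b * ?c = 2 * x * (1 - x^2) * z * (1 + 3 * x^2)"
    by algebra
  then have D: "?a * ?d - ?b * ?c \<noteq> 0"
    using 2 \<open>x \<noteq> 0\<close> \<open>z \<noteq> 0\<close> \<open>1 - x^2 \<noteq> 0\<close> \<open>1 + 3 * x^2 \<noteq> 0\<close> by simp
  \<comment> \<open>Each of the four differences, the second one tripled, is a combination of the
    vanishing quantities \<open>z^3 - 2\<close>, \<open>3 * x^4 + 6 * x^2 - 1\<close> and
    \<open>3 * \<mu> + 1\<close>.\<close>
  have "(?a^3 + ?b^3) - (?a * ?c^2 + ?b * ?d^2) =
      (z^3 - 2) * (x * (1 - x^2)^4) - 2 * x * (1 - x^2)^2 * (3 * x^4 + 6 * x^2 - 1)"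
    by algebra
  then have "(?a^3 + ?b^3) - (?a * ?c^2 + ?b * ?d^2) = 0"
    by (simp only: x' z diff_self mult_zero_left mult_zero_right)
  then have E1: "?a^3 + ?b^3 = ?a * ?c^2 + ?b * ?d^2"
    by (rule right_minus_eq[THEN iffD1])
  have "3 * ((?a^2 * ?c + ?b^2 * ?d) - \<mu> * (?c^3 + ?d^3)) =
      (18 * x^4 + 12 * x^2 + 2) * (3 * x^4 + 6 * x^2 - 1) -
      (3 * x^2 + 1) * (1 - x^2)^3 * (z^3 - 2) - (3 * \<mu> + 1) * (?c^3 + ?d^3)"
    by algebra
  then have "3 * ((?a^2 * ?c + ?b^2 * ?d) - \<mu> * (?c^3 + ?d^3)) = 0"
    by (simp only: x' z \<mu> mult_zero_left mult_zero_right diff_self)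
  then have "(?a^2 * ?c + ?b^2 * ?d) - \<mu> * (?c^3 + ?d^3) = 0"
    using 3 by (metis mult_eq_0_iff)
  then have E2: "?a^2 * ?c + ?b^2 * ?d = \<mu> * (?c^3 + ?d^3)"
    by (rule right_minus_eq[THEN iffD1])
  have "3 * ?a * ?b^2 - (?a * ?d^2 + 2 * ?b * ?c * ?d) =
      - 2 * x * (1 - x^2)^2 * z^2 * (3 * x^4 + 6 * x^2 - 1)"
    by algebra
  then have "3 * ?a * ?b^2 - (?a * ?d^2 + 2 * ?b * ?c * ?d) = 0"
    by (simp only: x' z \<mu> mult_zero_left mult_zero_right diff_self)
  then have E3: "3 * ?a * ?b^2 = ?a * ?d^2 + 2 * ?b * ?c * ?d"
    by (rule right_minus_eq[THEN iffD1])
  have "2 * ?a * ?b * ?d + ?b^2 * ?c - \<mu> * (3 * ?c * ?d^2) =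
      - 4 * x^2 * ?d^2 * (3 * \<mu> + 1)"
    by algebra
  then have "2 * ?a * ?b * ?d + ?b^2 * ?c - \<mu> * (3 * ?c * ?d^2) = 0"
    by (simp only: x' z \<mu> mult_zero_left mult_zero_right diff_self)
  then have E4: "2 * ?a * ?b * ?d + ?b^2 * ?c = \<mu> * (3 * ?c * ?d^2)"
    by (rule right_minus_eq[THEN iffD1])
  show ?L
    by (intro exI conjI) (rule D E1 E2 E3 E4)+
qed

subsection \<open>Arithmetic conditions\<close>

text \<open>Completing the square turns \<open>3 t^4 + 6 t^2 = 1\<close> into
  \<open>3 (t^2 + 1)^2 = 4\<close>, so 3 must be a square; whether -1 is a square as well separates
  the two residues modulo 12.\<close>

theorem theorem7p7:
  fixes \<mu> :: "'a::{field,finite}"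
  assumes "CARD('a) \<ge> 5"
    and "\<mu> \<noteq> 0" and "\<mu> \<noteq> 1"
    and "odd CARD('a) \<and> CARD('a) mod 3 \<noteq> 0 \<longrightarrow> \<mu> \<noteq> 1/9"
  shows "same_orbit L_c (ell \<mu>) \<longleftrightarrow>
    (odd CARD('a) \<and> \<mu> = -1/3 \<and>
      ((CARD('a) mod 12 = 11 \<and> \<not> (\<exists>y. \<mu> = y^2)) \<or>
       (CARD('a) mod 12 = 1 \<and> (\<exists>y. \<mu> = y^2) \<and> (\<exists>y::'a. 1/2 = y^3)
          \<and> (\<exists>y::'a. -1/3 = y^4))))"
    (is "_ \<longleftrightarrow> ?R")
proof -
  let ?S = "(2::'a) \<noteq> 0 \<and> 3 * \<mu> + 1 = 0 \<and>
    (\<exists>z::'a. z^3 = 2) \<and> (\<exists>x::'a. 3 * x^4 + 6 * x^2 = 1)"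
  have "same_orbit L_c (ell \<mu>) \<longleftrightarrow> ?S"
    unfolding same_orbit_iff[OF assms(1)] by (rule pencil_equiv_iff[OF assms(3)])
  also have "?S \<longleftrightarrow> ?R"
  proof
    assume ?S
    then obtain z x :: 'a where 2: "(2::'a) \<noteq> 0" and \<mu>: "3 * \<mu> + 1 = 0" and z: "z^3 = 2"
      and x: "3 * x^4 + 6 * x^2 = 1"
      by blast
    have 3: "(3::'a) \<noteq> 0"
      using \<mu> by auto
    have \<mu>': "\<mu> = -1/3"
      using \<mu> 3 by (simp add: field_simps eq_neg_iff_add_eq_0)
    have odd: "odd CARD('a)"
      by (rule two_ne_zero_imp_odd_card[OF 2])
    define r where "r = 2 / (x^2 + 1)"
    have x4: "3 * (x^2 + 1)^2 = 2^2"
      using x by algebra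
    then have "x^2 + 1 \<noteq> 0"
      using 2 by (metis mult_zero_right power_not_zero zero_power2)
    then have r: "r^2 = 3"
      unfolding r_def power_divide x4[symmetric] by simp
    have "r \<noteq> 0"
      using r 3 by auto
    \<comment> \<open>As 3 is a square, -3 is a square exactly when -1 is; this fixes q modulo both
      3 and 4.\<close>
    show ?R
    proof (cases "\<exists>i::'a. i^2 = -1")
      case True
      then obtain i :: 'a where i: "i^2 = -1" ..
      have "CARD('a) mod 4 = 1"
        by (rule minus_one_square_imp_card_mod_four[OF i 2])
      moreover have "CARD('a) mod 3 = 1"
        by (rule minus_three_square_imp_card_mod_three[of "i * r"])
          (use i r 2 3 in \<open>simp_all add: power_mult_distrib\<close>)
      ultimately have "CARD('a) mod 12 = 1"
        by presburger
      define m where "m = i / r"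
      have m: "-1/3 = m^2"
        by (simp add: m_def power_divide i r)
      then have m3: "3 * m^2 = -1"
        using 3 by (simp flip: m)
      have "x \<noteq> 0"
        using x by auto
      \<comment> \<open>Dividing \<open>x^4 + 2 x^2 + m^2 = 0\<close> by \<open>x^2\<close> gives
        \<open>s^2 = 2 * m - 2\<close>. This exhibits \<open>m\<close> as a square, hence
        \<open>-1/3 = m^2\<close> as a fourth power.\<close>
      define s where "s = x + m / x"
      have "x * s = x^2 + m"
        using \<open>x \<noteq> 0\<close> by (simp add: s_def field_simps power2_eq_square)
      then have "3 * (x^2 * s^2) = 3 * (x^2 * (2 * m - 2))"
        using x m3 by algebra
      then have s: "s^2 = 2 * m - 2"
        using 3 \<open>x \<noteq> 0\<close> by simp
      have "3 * m - 1 \<noteq> 0"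
      proof
        assume "3 * m - 1 = 0"
        moreover have "2^2 = 3 * (3 * m^2 + 1) - (3 * m - 1) * (3 * m + 1)"
          by algebra
        ultimately have "(2::'a)^2 = 0"
          using m3 by simp
        then show False
          using 2 by (metis power_not_zero)
      qed
      moreover have "m * (3 * m - 1)^2 = (i * s)^2"
        using s m3 i by algebra
      ultimately have "m = (i * s / (3 * m - 1))^2"
        by (simp add: power_divide field_simps)
      then have "-1/3 = (i * s / (3 * m - 1))^4"
        unfolding m by (metis power_mult num_double numeral_times_numeral)
      moreover have "1/2 = (1/z)^3"
        by (simp add: power_divide z)
      ultimately show ?R
        using odd \<mu>' m \<open>CARD('a) mod 12 = 1\<close> by metis
    next
      case False
      have "CARD('a) mod 3 = 2"
      proof (rule minus_three_not_square_imp_card_mod_three, rule notI, elim exE)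
        fix t :: 'a
        assume "t^2 = -3"
        then have "(t / r)^2 = -1"
          using r 3 by (simp add: power_divide)
        with False show False
          by blast
      qed
      moreover have "CARD('a) mod 4 \<noteq> 1"
        using False card_mod_four_imp_minus_one_square by blast
      ultimately have "CARD('a) mod 12 = 11"
        using odd by presburger
      moreover have "\<not> (\<exists>y. \<mu> = y^2)"
      proof
        assume "\<exists>y. \<mu> = y^2"
        then obtain y where "\<mu> = y^2" ..
        then have "(y * r)^2 = -1"
          using r \<mu> by algebra
        with False show False
          by blast
      qed
      ultimately show ?R
        using odd \<mu>' by blast
    qed
  next
    assume R: ?R
    then have 2: "(2::'a) \<noteq> 0"
      using odd_card_imp_two_ne_zero by blast
    \<comment> \<open>Division by zero gives 0, so \<open>3 = 0\<close> would make
      \<open>\<mu> = -1/3\<close> equal to 0.\<close>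
    have 3: "(3::'a) \<noteq> 0"
      using R assms(2) by auto
    have \<mu>: "3 * \<mu> + 1 = 0"
      using R 3 by simp
    consider "CARD('a) mod 12 = 11" | y n :: 'a where "CARD('a) mod 12 = 1" "1/2 = y^3" "-1/3 = n^4"
      using R by blast
    then have "(\<exists>z::'a. z^3 = 2) \<and> (\<exists>x::'a. 3 * x^4 + 6 * x^2 = 1)"
    proof cases
      case 1
      then have q: "CARD('a) mod 3 = 2" "CARD('a) mod 4 = 3"
        by presburger+
      have "\<not> (\<exists>r::'a. r^2 = -3)"
        using minus_three_square_imp_card_mod_three 2 3 q(1) by fastforce
      then obtain r :: 'a where r: "r^2 = 3"
        using square_or_minus_square[OF q(2), of 3] by blast
      have "r \<noteq> 0"
        using r 3 by auto
      \<comment> \<open>The roots of \<open>3 X^2 + 6 X - 1\<close> are \<open>2 / r - 1\<close> and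
        \<open>- 2 / r - 1\<close>; one of them must be shown to be a square.\<close>
      obtain y where "y^2 = 2 / r - 1 \<or> y^2 = - (2 / r - 1)"
        using square_or_minus_square[OF q(2)] by blast
      then have "\<exists>x::'a. 3 * x^4 + 6 * x^2 = 1"
      proof
        assume "y^2 = 2 / r - 1"
        then have "r * y^2 = 2 - r"
          using \<open>r \<noteq> 0\<close> by (simp add: right_diff_distrib)
        moreover have "(r * y^2)^2 + 2 * r * (r * y^2) = r^2 * (y^4 + 2 * y^2)"
          by algebra
        moreover have "(2 - r)^2 + 2 * r * (2 - r) = 4 - r^2"
          by algebra
        ultimately have "3 * y^4 + 6 * y^2 = 1"
          using r by (simp add: distrib_left)
        then show ?thesis ..
      next
        assume "y^2 = - (2 / r - 1)"
        then have y: "r * y^2 = r - 2"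
          using \<open>r \<noteq> 0\<close> by (simp add: right_diff_distrib)
        have "y \<noteq> 0"
        proof
          assume "y = 0"
          then have "r = 2"
            using y by simp
          then have "(4::'a) = 3"
            using r by simp
          moreover have "(4::'a) = 3 + 1"
            by simp
          ultimately show False
            by (metis add_cancel_right_right zero_neq_one)
        qed
        have "(r * y^2)^2 - 2 * r * (r * y^2) = r^2 * (y^4 - 2 * y^2)"
          by algebra
        moreover have "(r - 2)^2 - 2 * r * (r - 2) = 4 - r^2"
          by algebra
        ultimately have "3 * (y^4 - 2 * y^2) = 1"
          using r y by simp
        then have y4: "3 * (y^2)^2 = 1 + 6 * y^2"
          by (simp add: right_diff_distrib diff_eq_eq flip: power_mult)
        \<comment> \<open>Here \<open>- y^2\<close> is a root of \<open>3 X^2 + 6 X - 1\<close>; the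
          product of the roots is -1/3, so the other root is the square
          \<open>1 / (3 y^2)\<close>.\<close>
        define p where "p = (1 / (r * y))^2"
        have p: "3 * p * y^2 = 1"
          using r 3 \<open>y \<noteq> 0\<close> by (simp add: p_def power_divide power_mult_distrib)
        have "3 * (y^2)^2 * (3 * p^2 + 6 * p) = (3 * p * y^2)^2 + 6 * y^2 * (3 * p * y^2)"
          by algebra
        also have "\<dots> = 3 * (y^2)^2 * 1"
          unfolding p y4 by simp
        finally have "3 * p^2 + 6 * p = 1"
          using 3 \<open>y \<noteq> 0\<close> by (metis mult_left_cancel mult_eq_0_iff power_not_zero)
        then have "3 * (1 / (r * y))^4 + 6 * (1 / (r * y))^2 = 1"
          by (simp add: p_def flip: power_mult)
        then show ?thesis ..
      qed
      then show ?thesis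
        using cube_surj[OF q(1)] by blast
    next
      case 2
      then have "CARD('a) mod 4 = 1"
        by presburger
      then obtain i :: 'a where i: "i^2 = -1"
        using card_mod_four_imp_minus_one_square by blast
      have n: "3 * n^4 = -1"
        using 3 by (simp flip: 2(3))
      \<comment> \<open>\<open>x = i n w + n w^2\<close> with the cube root of unity \<open>w = (3 n^2 - 1) / 2\<close>.\<close>
      define x where "x = (3 * i * n^3 - i * n - n - 3 * n^3) / 2"
      have "2 * x = 3 * i * n^3 - i * n - n - 3 * n^3"
        using \<open>(2::'a) \<noteq> 0\<close> by (simp add: x_def)
      then have "2^4 * (3 * x^4 + 6 * x^2) = 2^4 * 1"
        using i n by algebra
      then have "3 * x^4 + 6 * x^2 = 1"
        using \<open>(2::'a) \<noteq> 0\<close> by (metis mult_left_cancel power_not_zero)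
      moreover have "(1 / y)^3 = 2"
        by (simp add: power_divide flip: 2(2))
      ultimately show ?thesis
        by blast
    qed
    with 2 \<mu> show ?S
      by blast
  qed
  finally show ?thesis .
qed

end
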